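(* Let $n$ be a natural number, let $E \subseteq \mathbb{R}^d$ be a set with the socialist filtration property through generation $n$ (with families $\mathcal{D}_{E,\ell}$, $0 \le \ell \le n$), and let $\{r_\ell : 0 \le \ell \le n\}$ be a strictly increasing sequence of real numbers with associated repulsion functional $\mathcal{Q}$. Let $\mu$ be a positive Borel probability measure supported on $E$ which minimizes $\mathcal{Q}$ among all positive Borel probability measures supported on $E$. Then for all $A, B \in \mathcal{D}_{E,n}$ we have $\mu(A) = \mu(B)$.
   Context: Filtration property: $E$ has the filtration property through generation $n$ if for each integer $0 \le \ell \le n$ there is a finite family $\mathcal{D}_{E,\ell}$ of pairwise disjoint nonempty Borel sets such that (i) for all integers $0 \le k \le \ell \le n$ and every $R \in \mathcal{D}_{E,\ell}$ there is a unique $P \in \mathcal{D}_{E,k}$ with $R \subseteq P$; this $P$ is called the generation $k$ ancestor of $R$ and is denoted $\widetilde{R}^{(k)}$; (ii) $E = \bigcup_{R \in \mathcal{D}_{E,n}} R$; (iii) $\mathcal{D}_{E,0}$ consists of a single set, so that any two members of $\mathcal{D}_{E,n}$ have a common ancestor. Socialist filtration property: $E$ has the filtration property through generation $n$ and there are nonnegative integers $N_\ell$ ($0 \le \ell \le n-1$) such that for every $0 \le \ell \le n-1$ and every $P \in \mathcal{D}_{E,\ell}$, $|\{Q \in \mathcal{D}_{E,\ell+1} : Q \subseteq P\}| = N_\ell$. Repulsion: for $Q, R \in \mathcal{D}_{E,n}$ put $r(Q,R) = r_\ell$, where $\ell$ is the largest integer in $\{0,\dots,n\}$ with $\widetilde{Q}^{(\ell)}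 = \widetilde{R}^{(\ell)}$. For a measure $\mu$ supported on $E$ (i.e. $\mu(\mathbb{R}^d \setminus E) = 0$), $\mathcal{Q}(\mu) = \sum_{Q \in \mathcal{D}_{E,n}} \sum_{R \in \mathcal{D}_{E,n}} \mu(Q)\mu(R)\, r(Q,R)$. *)

theory Defs
  imports "HOL-Analysis.Analysis" "HOL-Probability.Probability"
begin

(* The families are part of the data: D l is the generation l family, and only D 0, ..., D n matter. *)

definition filtration_property ::
    "nat \<Rightarrow> 'a::topological_space set \<Rightarrow> (nat \<Rightarrow> 'a set set) \<Rightarrow> bool" where
  "filtration_property n E D \<longleftrightarrow>
     (\<forall>l\<le>n. finite (D l) \<and> disjoint (D l) \<and> (\<forall>P\<in>D l. P \<noteq> {} \<and> P \<in> sets borel)) \<and>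
     (\<forall>k l. k \<le> l \<longrightarrow> l \<le> n \<longrightarrow> (\<forall>R\<in>D l. \<exists>!P. P \<in> D k \<and> R \<subseteq> P)) \<and>
     E = (\<Union>R\<in>D n. R) \<and>
     (\<exists>P. D 0 = {P})"

definition socialist_filtration_property ::
    "nat \<Rightarrow> 'a::topological_space set \<Rightarrow> (nat \<Rightarrow> 'a set set) \<Rightarrow> bool" where
  "socialist_filtration_property n E D \<longleftrightarrow>
     filtration_property n E D \<and>
     (\<exists>N :: nat \<Rightarrow> nat. \<forall>l<n. \<forall>P\<in>D l. card {Q \<in> D (l + 1). Q \<subseteq> P} = N l)"

definition ancestor :: "(nat \<Rightarrow> 'a set set) \<Rightarrow> nat \<Rightarrow> 'a set \<Rightarrow> 'a set" where
  "ancestor D k R = (THE P. P \<in> D k \<and> R \<subseteq> P)"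

(* Under the filtration property the set under Max contains 0. *)
definition repulsion ::
    "nat \<Rightarrow> (nat \<Rightarrow> 'a set set) \<Rightarrow> (nat \<Rightarrow> real) \<Rightarrow> 'a set \<Rightarrow> 'a set \<Rightarrow> real" where
  "repulsion n D r Q R = r (Max {l \<in> {0..n}. ancestor D l Q = ancestor D l R})"

definition repulsion_functional ::
    "nat \<Rightarrow> (nat \<Rightarrow> 'a set set) \<Rightarrow> (nat \<Rightarrow> real) \<Rightarrow> 'a measure \<Rightarrow> real" where
  "repulsion_functional n D r \<mu> =
     (\<Sum>Q\<in>D n. \<Sum>R\<in>D n. measure \<mu> Q * measure \<mu> R * repulsion n D r Q R)"

definition borel_prob_measures_on :: "'a::topological_space set \<Rightarrow> 'a measure set" where
  "borel_prob_measures_on E =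
     {\<mu>. sets \<mu> = sets borel \<and> prob_space \<mu> \<and> emeasure \<mu> (UNIV - E) = 0}"

end

theory Submission
  imports Defs
begin

text \<open>
  Two cells of the last generation share an ancestor in generations \<open>0, \<dots>, M\<close> and in no later one,
  so telescoping \<open>r M\<close> writes the repulsion as \<open>r 0\<close> plus a sum, over the generations \<open>l < n\<close>, of the
  positive gap \<open>r (Suc l) - r l\<close> whenever the two ancestors in generation \<open>Suc l\<close> agree
  (\<open>repulsion_telescope\<close>). Summing over all pairs, the functional of a probability measure becomes
  the constant \<open>r 0\<close> plus a positive combination of sums of squares, one for each generation after the
  root. The numbers squared are the masses that the cells of this generation receive from their
  descendants in generation \<open>n\<close> (\<open>functional_eq_sum_squares\<close>).

  For numbers with total 1 the sum of squares is the reciprocal of their number plus the sum of the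
  squared deviations from the mean. Hence each generation contributes least when its masses are equal.
  The socialist property makes these requirements compatible: all cells of one generation have equally
  many descendants (\<open>card_descendants\<close>), so a measure that charges the last generation uniformly
  charges every generation uniformly and attains all the minima at once. A minimizer must therefore
  have zero deviation in every generation after the root, in particular in the last one. For
  \<open>n = 0\<close> there is only one cell.
\<close>

section \<open>Ancestors\<close>

locale filtration =
  fixes n :: nat and E :: "'a::topological_space set" and D :: "nat \<Rightarrow> 'a set set"
  assumes filtration: "filtration_property n E D"
begin

lemma finite_generation: "l \<le> n \<Longrightarrow> finite (D l)"
  and disjoint_generation: "l \<le> n \<Longrightarrow> disjoint (D l)"
  and cell_nonempty: "l \<le> n \<Longrightarrow> P \<in> D l \<Longrightarrow> P \<noteq> {}"
  and cell_borel: "l \<le> n \<Longrightarrow> P \<in> D l \<Longrightarrow> P \<in> sets borel"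
  and ancestor_ex1: "k \<le> l \<Longrightarrow> l \<le> n \<Longrightarrow> R \<in> D l \<Longrightarrow> \<exists>!P. P \<in> D k \<and> R \<subseteq> P"
  and support_eq: "E = \<Union>(D n)"
  and root: "\<exists>P. D 0 = {P}"
  using filtration unfolding filtration_property_def by auto

lemma ancestor_in: "k \<le> l \<Longrightarrow> l \<le> n \<Longrightarrow> R \<in> D l \<Longrightarrow> ancestor D k R \<in> D k"
  and ancestor_superset: "k \<le> l \<Longrightarrow> l \<le> n \<Longrightarrow> R \<in> D l \<Longrightarrow> R \<subseteq> ancestor D k R"
  using theI'[OF ancestor_ex1[of k l R]] unfolding ancestor_def by auto

lemma ancestor_eqI:
  "k \<le> l \<Longrightarrow> l \<le> n \<Longrightarrow> R \<in> D l \<Longrightarrow> P \<in> D k \<Longrightarrow> R \<subseteq> P \<Longrightarrow> ancestor D k R = P"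
  using ancestor_ex1[of k l R] ancestor_in[of k l R] ancestor_superset[of k l R] by blast

lemma ancestor_self: "l \<le> n \<Longrightarrow> R \<in> D l \<Longrightarrow> ancestor D l R = R"
  by (rule ancestor_eqI[of l l]) auto

lemma ancestor_ancestor:
  assumes "j \<le> k" "k \<le> l" "l \<le> n" "R \<in> D l"
  shows "ancestor D j (ancestor D k R) = ancestor D j R"
proof -
  have k: "ancestor D k R \<in> D k" "R \<subseteq> ancestor D k R"
    using assms ancestor_in ancestor_superset by auto
  have "ancestor D j (ancestor D k R) \<in> D j" "ancestor D k R \<subseteq> ancestor D j (ancestor D k R)"
    using k(1) assms ancestor_in[of j k] ancestor_superset[of j k] by auto
  then show ?thesis
    using k(2) assms ancestor_eqI[of j l R "ancestor D j (ancestor D k R)"] by auto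
qed

lemma sum_by_ancestor:
  assumes "l \<le> n"
  shows "(\<Sum>P\<in>D l. \<Sum>Q\<in>{Q \<in> D n. ancestor D l Q = P}. f Q) = (\<Sum>Q\<in>D n. f Q)"
  by (rule sum.group) (use assms finite_generation ancestor_in in auto)

section \<open>The functional as a combination of sums of squares\<close>

lemma repulsion_telescope:
  assumes Q: "Q \<in> D n" and R: "R \<in> D n"
  shows "repulsion n D r Q R =
    r 0 + (\<Sum>l<n. (r (Suc l) - r l) * of_bool (ancestor D (Suc l) Q = ancestor D (Suc l) R))"
proof -
  define S where "S = {l \<in> {0..n}. ancestor D l Q = ancestor D l R}"
  define M where "M = Max S"
  have "ancestor D 0 Q = ancestor D 0 R"
    using root ancestor_in[of 0 n Q] ancestor_in[of 0 n R] Q R by auto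
  then have "0 \<in> S" and "finite S" by (auto simp: S_def)
  then have M: "M \<in> S" "\<And>l. l \<in> S \<Longrightarrow> l \<le> M"
    unfolding M_def by (auto intro: Max_in)
  (* Cells with a common ancestor share all earlier ones as well, so S has no gaps below M. *)
  have down: "l \<in> S" if "l \<le> M" for l
  proof -
    have "ancestor D M Q = ancestor D M R" "M \<le> n" using M(1) by (auto simp: S_def)
    then have "ancestor D l Q = ancestor D l R"
      using ancestor_ancestor[of l M n Q] ancestor_ancestor[of l M n R] Q R that by simp
    with that \<open>M \<le> n\<close> show ?thesis by (simp add: S_def)
  qed
  have iff: "ancestor D (Suc l) Q = ancestor D (Suc l) R \<longleftrightarrow> l < M" if "l < n" for l
    using down[of "Suc l"] M(2)[of "Suc l"] that by (auto simp: S_def)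
  have "(\<Sum>l<n. (r (Suc l) - r l) * of_bool (ancestor D (Suc l) Q = ancestor D (Suc l) R))
      = (\<Sum>l<n. (r (Suc l) - r l) * of_bool (l < M))"
    by (intro sum.cong refl) (simp add: iff)
  also have "\<dots> = (\<Sum>l<M. r (Suc l) - r l)"
    by (rule sum.mono_neutral_cong_right) (use M(1) in \<open>auto simp: S_def\<close>)
  also have "\<dots> = r M - r 0"
    by (rule sum_lessThan_telescope)
  finally show ?thesis
    by (simp add: repulsion_def M_def S_def)
qed

text \<open>
  Expanding the square of the mass of an ancestor gives one term for each ordered pair of its
  descendants.
\<close>

lemma sum_pairs_common_ancestor:
  fixes w :: "'a set \<Rightarrow> real"
  assumes l: "l \<le> n"
  shows "(\<Sum>Q\<in>D n. \<Sum>R\<in>D n. w Q * w R * of_bool (ancestor D l Q = ancestor D l R))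
    = (\<Sum>P\<in>D l. (\<Sum>Q\<in>{Q \<in> D n. ancestor D l Q = P}. w Q)\<^sup>2)"
proof -
  have fin: "finite (D n)" using finite_generation by simp
  have "(\<Sum>Q\<in>D n. \<Sum>R\<in>D n. w Q * w R * of_bool (ancestor D l Q = ancestor D l R))
      = (\<Sum>Q\<in>D n. w Q * (\<Sum>R\<in>{R \<in> D n. ancestor D l R = ancestor D l Q}. w R))"
  proof (intro sum.cong refl)
    fix Q assume "Q \<in> D n"
    show "(\<Sum>R\<in>D n. w Q * w R * of_bool (ancestor D l Q = ancestor D l R))
        = w Q * (\<Sum>R\<in>{R \<in> D n. ancestor D l R = ancestor D l Q}. w R)"
      unfolding sum_distrib_left
      by (rule sum.mono_neutral_cong_right) (use fin in auto)
  qed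
  also have "\<dots> = (\<Sum>P\<in>D l. \<Sum>Q\<in>{Q \<in> D n. ancestor D l Q = P}.
      w Q * (\<Sum>R\<in>{R \<in> D n. ancestor D l R = ancestor D l Q}. w R))"
    by (rule sum_by_ancestor[OF l, symmetric])
  also have "\<dots> = (\<Sum>P\<in>D l. (\<Sum>Q\<in>{Q \<in> D n. ancestor D l Q = P}. w Q)\<^sup>2)"
    by (intro sum.cong refl) (simp add: power2_eq_square sum_distrib_right)
  finally show ?thesis .
qed

lemma functional_eq_sum_squares:
  "repulsion_functional n D r \<mu> = r 0 * (\<Sum>Q\<in>D n. measure \<mu> Q)\<^sup>2 +
    (\<Sum>l<n. (r (Suc l) - r l) *
      (\<Sum>P\<in>D (Suc l). (\<Sum>Q\<in>{Q \<in> D n. ancestor D (Suc l) Q = P}. measure \<mu> Q)\<^sup>2))"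
proof -
  let ?w = "measure \<mu>"
  let ?b = "\<lambda>l Q R. of_bool (ancestor D (Suc l) Q = ancestor D (Suc l) R) :: real"
  have "repulsion_functional n D r \<mu> =
      (\<Sum>Q\<in>D n. \<Sum>R\<in>D n. r 0 * (?w Q * ?w R) + (\<Sum>l<n. (r (Suc l) - r l) * (?w Q * ?w R * ?b l Q R)))"
    unfolding repulsion_functional_def
    by (intro sum.cong refl)
       (simp add: repulsion_telescope distrib_left sum_distrib_left mult_ac del: sum_mult_of_bool_eq)
  also have "\<dots> = r 0 * (\<Sum>Q\<in>D n. \<Sum>R\<in>D n. ?w Q * ?w R) +
      (\<Sum>Q\<in>D n. \<Sum>R\<in>D n. \<Sum>l<n. (r (Suc l) - r l) * (?w Q * ?w R * ?b l Q R))"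
    by (simp add: sum.distrib sum_distrib_left)
  also have "(\<Sum>Q\<in>D n. \<Sum>R\<in>D n. ?w Q * ?w R) = (\<Sum>Q\<in>D n. ?w Q)\<^sup>2"
    by (simp add: power2_eq_square sum_product)
  also have "(\<Sum>Q\<in>D n. \<Sum>R\<in>D n. \<Sum>l<n. (r (Suc l) - r l) * (?w Q * ?w R * ?b l Q R))
      = (\<Sum>Q\<in>D n. \<Sum>l<n. \<Sum>R\<in>D n. (r (Suc l) - r l) * (?w Q * ?w R * ?b l Q R))"
    by (intro sum.cong refl sum.swap)
  also have "\<dots> = (\<Sum>l<n. \<Sum>Q\<in>D n. \<Sum>R\<in>D n. (r (Suc l) - r l) * (?w Q * ?w R * ?b l Q R))"
    by (rule sum.swap)
  also have "\<dots> = (\<Sum>l<n. (r (Suc l) - r l) * (\<Sum>Q\<in>D n. \<Sum>R\<in>D n. ?w Q * ?w R * ?b l Q R))"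
    by (simp only: sum_distrib_left)
  also have "\<dots> = (\<Sum>l<n. (r (Suc l) - r l) *
      (\<Sum>P\<in>D (Suc l). (\<Sum>Q\<in>{Q \<in> D n. ancestor D (Suc l) Q = P}. ?w Q)\<^sup>2))"
    by (intro sum.cong refl) (simp add: sum_pairs_common_ancestor)
  finally show ?thesis .
qed

section \<open>Uniform measures and descendant counts\<close>

lemma sum_measure_cells:
  assumes \<mu>: "\<mu> \<in> borel_prob_measures_on E"
  shows "(\<Sum>Q\<in>D n. measure \<mu> Q) = 1"
proof -
  have sets: "sets \<mu> = sets borel" and "prob_space \<mu>" and null: "emeasure \<mu> (UNIV - E) = 0"
    using \<mu> by (auto simp: borel_prob_measures_on_def)
  interpret prob_space \<mu> by fact
  have fin: "finite (D n)" using finite_generation by simp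
  have cells: "\<And>Q. Q \<in> D n \<Longrightarrow> Q \<in> sets \<mu>"
    using cell_borel[of n] sets by simp
  have E: "E \<in> sets \<mu>"
    unfolding support_eq using fin cells by (intro sets.finite_Union) auto
  have "space \<mu> = UNIV"
    using sets_eq_imp_space_eq[OF sets] by simp
  then have "prob E = 1"
    using prob_compl[OF E] null by (simp add: measure_def)
  moreover have "prob (\<Union>Q\<in>D n. Q) = (\<Sum>Q\<in>D n. prob Q)"
    by (rule finite_measure_finite_Union)
       (use fin cells disjoint_generation[of n] in
         \<open>auto simp: disjoint_family_on_def disjoint_def\<close>)
  ultimately show ?thesis by (simp add: support_eq)
qed

text \<open>Such a measure is obtained by placing equal point masses, one in each cell.\<close>

lemma uniform_measure_exists:
  assumes "D n \<noteq> {}"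
  shows "\<exists>\<nu>\<in>borel_prob_measures_on E. \<forall>Q\<in>D n. measure \<nu> Q = 1 / card (D n)"
proof -
  have fin: "finite (D n)" using finite_generation by simp
  define x where "x = (\<lambda>Q :: 'a set. SOME y. y \<in> Q)"
  have x: "x Q \<in> Q" if "Q \<in> D n" for Q
    using cell_nonempty[of n Q] that by (simp add: x_def some_in_eq)
  have same: "Q = R" if "Q \<in> D n" "R \<in> D n" "x Q \<in> R" for Q R
    using disjoint_generation[of n] x[OF that(1)] that by (auto simp: disjoint_def)
  have inj: "inj_on x (D n)"
    using same x by (metis inj_onI)
  let ?X = "x ` D n"
  define \<nu> where "\<nu> = distr (measure_pmf (pmf_of_set ?X)) borel (\<lambda>y. y)"
  have X: "finite ?X" "?X \<noteq> {}" using fin assms by auto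
  have emeasure: "emeasure \<nu> A = measure_pmf.prob (pmf_of_set ?X) A" if "A \<in> sets borel" for A
    using that by (simp add: \<nu>_def emeasure_distr measure_pmf.emeasure_eq_measure)
  have "measure \<nu> Q = 1 / card (D n)" if Q: "Q \<in> D n" for Q
  proof -
    have "?X \<inter> Q = {x Q}"
      using same[of _ Q] x[OF Q] Q by auto
    then have "measure_pmf.prob (pmf_of_set ?X) Q = 1 / card (D n)"
      using measure_pmf_of_set[OF X(2,1), of Q] card_image[OF inj] by simp
    then show ?thesis
      using emeasure[OF cell_borel[OF order.refl Q]] by (simp add: measure_def)
  qed
  moreover have "\<nu> \<in> borel_prob_measures_on E"
  proof -
    have "E \<in> sets borel"
      unfolding support_eq using fin cell_borel[of n] by (intro sets.finite_Union) auto
    then have "UNIV - E \<in> sets borel"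
      by (metis sets.compl_sets space_borel)
    moreover have "?X \<inter> (UNIV - E) = {}"
      using x by (auto simp: support_eq)
    ultimately have "emeasure \<nu> (UNIV - E) = 0"
      using emeasure measure_pmf_of_set[OF X(2,1), of "UNIV - E"] by simp
    moreover have "prob_space \<nu>"
      unfolding \<nu>_def by (rule measure_pmf.prob_space_distr) simp
    ultimately show ?thesis
      by (simp add: borel_prob_measures_on_def \<nu>_def)
  qed
  ultimately show ?thesis by blast
qed

end

text \<open>
  Going back one generation multiplies the count by the number of children, because the descendants
  of a cell are partitioned by their ancestors among its children; hence the count is the product of
  the branching numbers from generation \<open>l\<close> on.
\<close>

lemma card_descendants:
  assumes "socialist_filtration_property n E D"
  obtains c where "\<And>l P. l \<le> n \<Longrightarrow> P \<in> D l \<Longrightarrow> card {Q \<in> D n. ancestor D l Q = P} = c l"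
proof -
  interpret filtration n E D
    using assms by unfold_locales (simp add: socialist_filtration_property_def)
  obtain N where N: "\<And>l P. l < n \<Longrightarrow> P \<in> D l \<Longrightarrow> card {Q \<in> D (Suc l). Q \<subseteq> P} = N l"
    using assms by (auto simp: socialist_filtration_property_def)
  have "card {Q \<in> D n. ancestor D l Q = P} = (\<Prod>i=l..<n. N i)" if "l \<le> n" "P \<in> D l" for l P
    using that
  proof (induction l arbitrary: P rule: inc_induct)
    case base
    have "{Q \<in> D n. ancestor D n Q = P} = {P}"
      using base ancestor_self[of n] by auto
    then show ?case by simp
  next
    case (step l)
    let ?T = "{P' \<in> D (Suc l). P' \<subseteq> P}"
    let ?S = "{Q \<in> D n. ancestor D l Q = P}"
    have iff: "ancestor D l P' = P \<longleftrightarrow> P' \<subseteq> P" if "P' \<in> D (Suc l)" for P'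
      using that step ancestor_eqI[of l "Suc l" P' P] ancestor_superset[of l "Suc l" P'] by auto
    have anc: "ancestor D (Suc l) Q \<in> D (Suc l)"
        "ancestor D l (ancestor D (Suc l) Q) = ancestor D l Q" if "Q \<in> D n" for Q
      using that step ancestor_in[of "Suc l" n Q] ancestor_ancestor[of l "Suc l" n Q] by auto
    have "card ?S = (\<Sum>P'\<in>?T. card {Q \<in> ?S. ancestor D (Suc l) Q = P'})"
    proof -
      have "ancestor D (Suc l) ` ?S \<subseteq> ?T"
        using iff anc by blast
      then show ?thesis
        using sum.group[of ?S ?T "ancestor D (Suc l)" "\<lambda>_. 1::nat"] step.hyps
          finite_generation[of n] finite_generation[of "Suc l"]
        by simp
    qed
    also have "\<dots> = (\<Sum>P'\<in>?T. \<Prod>i=Suc l..<n. N i)"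
    proof (intro sum.cong refl)
      fix P' assume P': "P' \<in> ?T"
      then have "{Q \<in> ?S. ancestor D (Suc l) Q = P'} = {Q \<in> D n. ancestor D (Suc l) Q = P'}"
        using iff[of P'] anc(2) by auto
      then show "card {Q \<in> ?S. ancestor D (Suc l) Q = P'} = (\<Prod>i=Suc l..<n. N i)"
        using step.IH P' by simp
    qed
    also have "\<dots> = (\<Prod>i=l..<n. N i)"
      using N[of l P] step by (simp add: prod.atLeast_Suc_lessThan)
    finally show ?case .
  qed
  then show thesis by (rule that)
qed

section \<open>Minimizers\<close>

lemma sum_squares_deviation:
  fixes f :: "'b \<Rightarrow> real"
  assumes "finite A" and "sum f A = 1"
  shows "(\<Sum>x\<in>A. (f x)\<^sup>2) = 1 / card A + (\<Sum>x\<in>A. (f x - 1 / card A)\<^sup>2)"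
proof -
  have "A \<noteq> {}" using assms(2) by auto
  then have card: "card A > 0" using assms(1) by (simp add: card_gt_0_iff)
  have "(\<Sum>x\<in>A. (f x - 1 / card A)\<^sup>2)
      = (\<Sum>x\<in>A. (f x)\<^sup>2) - 2 / card A * sum f A + card A * (1 / card A)\<^sup>2"
    by (simp add: power2_diff sum.distrib sum_subtractf
        flip: sum_distrib_left sum_distrib_right sum_divide_distrib)
  also have "\<dots> = (\<Sum>x\<in>A. (f x)\<^sup>2) - 1 / card A"
    using card assms(2) by (simp add: power2_eq_square divide_simps)
  finally show ?thesis by simp
qed

theorem mainTheorem1:
  fixes n :: nat
    and E :: "(real ^ 'd) set"
    and D :: "nat \<Rightarrow> (real ^ 'd) set set"
    and r :: "nat \<Rightarrow> real"
    and \<mu> :: "(real ^ 'd) measure"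
  assumes "socialist_filtration_property n E D"
    and "strict_mono_on {0..n} r"
    and "\<mu> \<in> borel_prob_measures_on E"
    and "\<forall>\<nu>\<in>borel_prob_measures_on E.
           repulsion_functional n D r \<mu> \<le> repulsion_functional n D r \<nu>"
  shows "\<forall>A\<in>D n. \<forall>B\<in>D n. measure \<mu> A = measure \<mu> B"
proof (cases n)
  case 0
  then show ?thesis
    using assms(1) by (auto simp: socialist_filtration_property_def filtration_property_def)
next
  case (Suc m)
  interpret filtration n E D
    using assms(1) by unfold_locales (simp add: socialist_filtration_property_def)
  define mass where "mass = (\<lambda>\<nu> :: (real ^ 'd) measure. \<lambda>l P.
    \<Sum>Q\<in>{Q \<in> D n. ancestor D l Q = P}. measure \<nu> Q)"
  define dev where "dev = (\<lambda>\<nu> l. \<Sum>P\<in>D l. (mass \<nu> l P - 1 / card (D l))\<^sup>2)"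
  have total: "(\<Sum>P\<in>D l. mass \<nu> l P) = 1" if "l \<le> n" "\<nu> \<in> borel_prob_measures_on E" for \<nu> l
    using that by (simp add: mass_def sum_by_ancestor sum_measure_cells)
  have functional: "repulsion_functional n D r \<nu>
      = r 0 + (\<Sum>l<n. (r (Suc l) - r l) * (1 / card (D (Suc l)) + dev \<nu> (Suc l)))"
    if \<nu>: "\<nu> \<in> borel_prob_measures_on E" for \<nu>
  proof -
    have "(\<Sum>P\<in>D (Suc l). (mass \<nu> (Suc l) P)\<^sup>2) = 1 / card (D (Suc l)) + dev \<nu> (Suc l)"
      if "l < n" for l
      unfolding dev_def using that \<nu> finite_generation total
      by (intro sum_squares_deviation) auto
    then show ?thesis
      using functional_eq_sum_squares[of r \<nu>] sum_measure_cells[OF \<nu>] by (simp add: mass_def)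
  qed
  have "D n \<noteq> {}"
    using sum_measure_cells[OF assms(3)] by auto
  then obtain \<nu> where \<nu>: "\<nu> \<in> borel_prob_measures_on E"
    and unif: "\<And>Q. Q \<in> D n \<Longrightarrow> measure \<nu> Q = 1 / card (D n)"
    using uniform_measure_exists by blast
  obtain c where c: "\<And>l P. l \<le> n \<Longrightarrow> P \<in> D l \<Longrightarrow> card {Q \<in> D n. ancestor D l Q = P} = c l"
    using card_descendants[OF assms(1)] by blast
  have dev_uniform: "dev \<nu> l = 0" if l: "l \<le> n" for l
  proof -
    define k where "k = c l / real (card (D n))"
    have k: "mass \<nu> l P = k" if "P \<in> D l" for P
      using c[OF l that] by (simp add: mass_def unif k_def)
    (* The masses all equal k, and their total 1 forces k to be the mean. *)
    then have "card (D l) * k = 1"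
      using total[OF l \<nu>] by simp
    then have "k = 1 / card (D l)"
      by (cases "card (D l) = 0") (simp_all add: eq_divide_eq mult.commute)
    then show ?thesis by (simp add: dev_def k)
  qed
  have gap: "r (Suc l) - r l > 0" if "l < n" for l
    using strict_mono_onD[OF assms(2), of l "Suc l"] that by simp
  have dev_nonneg: "dev \<mu> l \<ge> 0" for l
    by (simp add: dev_def sum_nonneg)
  have "repulsion_functional n D r \<mu> \<le> repulsion_functional n D r \<nu>"
    using assms(4) \<nu> by blast
  then have "(\<Sum>l<n. (r (Suc l) - r l) * dev \<mu> (Suc l)) \<le> 0"
    using functional[OF assms(3)] functional[OF \<nu>]
    by (simp add: dev_uniform distrib_left sum.distrib)
  moreover have nonneg: "(r (Suc l) - r l) * dev \<mu> (Suc l) \<ge> 0" if "l \<in> {..<n}" for l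
    using gap[of l] dev_nonneg[of "Suc l"] that by simp
  ultimately have "(\<Sum>l<n. (r (Suc l) - r l) * dev \<mu> (Suc l)) = 0"
    by (intro antisym sum_nonneg)
  then have "(r (Suc m) - r m) * dev \<mu> (Suc m) = 0"
    using sum_nonneg_0[of "{..<n}" "\<lambda>l. (r (Suc l) - r l) * dev \<mu> (Suc l)" m] nonneg Suc
    by blast
  then have "dev \<mu> n = 0"
    using gap[of m] Suc by auto
  then have mean: "mass \<mu> n P = 1 / card (D n)" if "P \<in> D n" for P
    using that finite_generation[of n] by (simp add: dev_def sum_nonneg_eq_0_iff)
  have "{Q \<in> D n. ancestor D n Q = P} = {P}" if "P \<in> D n" for P
    using that ancestor_self[of n] by auto
  then have "measure \<mu> P = 1 / card (D n)" if "P \<in> D n" for P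
    using mean[OF that] that by (simp add: mass_def)
  then show ?thesis by simp
qed

end
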